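(* Let $z\in\mathcal{L}^*\cap Q_1$, and write $z=(B+i)/D$ with $B,D\in\mathbb{Z}$ and $A=(B^2+1)/D$. Then $z$ is not visible if and only if there exist integers $a,b,d$ with $1\le a\le b<d$, $ad=b^2+1$ and $b\mid B$, such that $$\frac{B}{b}=\frac{D-A}{d-a}\ne 1.$$
   Context: $\mathbb{H}$ is the upper half-plane with the Poincaré metric $ds^2=y^{-2}(dx^2+dy^2)$; $\mathrm{SL}_2(\mathbb{Z})$ acts on it by fractional linear transformations $\begin{pmatrix} a & b \\ c & d \end{pmatrix}z=\frac{az+b}{cz+d}$. $\mathcal{L}=\{\gamma(i):\gamma\in \mathrm{SL}_2(\mathbb{Z})\}$ is the orbit of $i$ and $\mathcal{L}^*=\mathcal{L}\setminus\{i\}$. A point $z\in\mathcal{L}$, $z\neq i$, is visible if the geodesic arc connecting $i$ and $z$ contains no point of $\mathcal{L}$ other than $i$ and $z$. $Q_1=\{z\in\mathbb{H}: |z|\le 1,\ \mathrm{Re}(z)\ge 0\}$. Every $z\in\mathcal{L}^*$ is uniquely written as $z=(B+i)/D$ with $B,D\in\mathbb{Z}$ (in fact, if $z=\gamma(i)$ with $\gamma=\begin{pmatrix} p & q \\ r & s \end{pmatrix}$, then $B=pr+qs$, $D=r^2+s^2$), and $A=(B^2+1)/D$ is an integer. *)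

theory Defs
  imports "HOL-Analysis.Analysis"
begin

definition upper_half_plane :: "complex set" where
  "upper_half_plane = {z. Im z > 0}"

definition SL2Z :: "(int^2^2) set" where
  "SL2Z = {M. det M = 1}"

definition frac_lin :: "int^2^2 \<Rightarrow> complex \<Rightarrow> complex" where
  "frac_lin M z = (of_int (M$1$1) * z + of_int (M$1$2)) / (of_int (M$2$1) * z + of_int (M$2$2))"

definition orbit_i :: "complex set" where
  "orbit_i = {frac_lin M \<i> | M. M \<in> SL2Z}"

definition orbit_i_star :: "complex set" where
  "orbit_i_star = orbit_i - {\<i>}"

definition Q1 :: "complex set" where
  "Q1 = {z \<in> upper_half_plane. norm z \<le> 1 \<and> Re z \<ge> 0}"

text \<open>Length for the metric $ds^2 = y^{-2}(dx^2 + dy^2)$. It is taken in \<^typ>\<open>ennreal\<close> because a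
  \<^const>\<open>valid_path\<close> may have unbounded derivative near an exceptional point and hence infinite
  length; a real-valued integral would give such a path length 0.\<close>

definition hyp_length :: "(real \<Rightarrow> complex) \<Rightarrow> ennreal" where
  "hyp_length \<gamma> =
     (\<integral>\<^sup>+t\<in>{0..1}. ennreal (norm (vector_derivative \<gamma> (at t)) / Im (\<gamma> t)) \<partial>lborel)"

definition hyp_path :: "complex \<Rightarrow> complex \<Rightarrow> (real \<Rightarrow> complex) \<Rightarrow> bool" where
  "hyp_path z w \<gamma> \<longleftrightarrow>
     valid_path \<gamma> \<and> path_image \<gamma> \<subseteq> upper_half_plane \<and> pathstart \<gamma> = z \<and> pathfinish \<gamma> = w"

definition geodesic_path :: "complex \<Rightarrow> complex \<Rightarrow> (real \<Rightarrow> complex) \<Rightarrow> bool" where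
  "geodesic_path z w \<gamma> \<longleftrightarrow>
     hyp_path z w \<gamma> \<and> (\<forall>\<delta>. hyp_path z w \<delta> \<longrightarrow> hyp_length \<gamma> \<le> hyp_length \<delta>)"

text \<open>In the hyperbolic plane any two points are joined by a shortest path that is unique up to
  reparametrization, so the union below is the image of any one such path.\<close>

definition geodesic_arc :: "complex \<Rightarrow> complex \<Rightarrow> complex set" where
  "geodesic_arc z w = (\<Union>\<gamma> \<in> Collect (geodesic_path z w). path_image \<gamma>)"

definition visible :: "complex \<Rightarrow> bool" where
  "visible z \<longleftrightarrow> z \<in> orbit_i \<and> z \<noteq> \<i> \<and> geodesic_arc \<i> z \<inter> orbit_i \<subseteq> {\<i>, z}"

lemma orbit_i_coordinates:
  assumes "z \<in> orbit_i"
  shows "\<exists>A B D :: int. z = (of_int B + \<i>) / of_int D \<and> D > 0 \<and>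
           real_of_int A = (real_of_int B ^ 2 + 1) / real_of_int D"
proof -
  obtain M where M: "det M = 1" "z = frac_lin M \<i>"
    using assms by (auto simp: orbit_i_def SL2Z_def)
  define p q r s where "p = M$1$1" and "q = M$1$2" and "r = M$2$1" and "s = M$2$2"
  note defs = p_def q_def r_def s_def
  have det: "p * s - q * r = 1"
    using M(1) by (simp add: det_2 defs)
  define A B D where "A = p^2 + q^2" and "B = p * r + q * s" and "D = r^2 + s^2"
  have "r \<noteq> 0 \<or> s \<noteq> 0" using det by auto
  then have D: "D > 0" by (simp add: D_def sum_power2_gt_zero_iff)
  have "A * D = B^2 + (p * s - q * r)^2"
    unfolding A_def B_def D_def by algebra
  then have AD: "A * D = B^2 + 1" using det by simp
  have ne: "of_int r * \<i> + of_int s \<noteq> (0::complex)"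
    using \<open>r \<noteq> 0 \<or> s \<noteq> 0\<close> by (auto simp: complex_eq_iff)
  have det': "of_int p * of_int s - of_int q * of_int r = (1::complex)"
    using arg_cong[OF det, of "of_int :: int \<Rightarrow> complex"] by simp
  have "(of_int p * \<i> + of_int q) * of_int D
        = (of_int B + (of_int p * of_int s - of_int q * of_int r) * \<i>) * (of_int r * \<i> + of_int s)"
    by (simp add: B_def D_def complex_eq_iff algebra_simps power2_eq_square)
  then have "z = (of_int B + \<i>) / of_int D"
    using D ne det' by (simp add: M(2) frac_lin_def field_simps flip: defs)
  moreover have "real_of_int A = (real_of_int B ^ 2 + 1) / real_of_int D"
    using D arg_cong[OF AD, of real_of_int] by (simp add: field_simps)
  ultimately show ?thesis using D by blast
qed

end

theory Submission
  imports Defs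
begin

text \<open>
  The geodesic through \<open>\<i>\<close> and \<open>z = (B + \<i>) / D\<close> is a semicircle centred on the real axis. A point
  \<open>(b + \<i>) / d\<close> with \<open>a d = b\<^sup>2 + 1\<close> lies on it exactly when \<open>(d - a) B = (D - A) b\<close>. Encode such a
  point by the symmetric matrix with rows \<open>(a, b)\<close> and \<open>(b, d)\<close>, which is positive definite of
  determinant \<open>1\<close>; the base point \<open>\<i>\<close> is the identity matrix. The linear condition then says that
  the matrices of the two points commute. Hence the orbit points on one geodesic through \<open>\<i>\<close> form a
  discrete group of commuting matrices, which is generated by the orbit point closest to \<open>\<i>\<close>, and
  the powers of a matrix have off-diagonal entries divisible by that of the matrix itself. This
  is where \<open>b dvd B\<close> comes from: if some orbit point lies strictly between \<open>\<i>\<close> and \<open>z\<close>, the closest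
  one on that ray has this divisibility property. The descent \<open>on_ray_quotient\<close>, which divides one
  matrix by another, replaces the group theory, and \<open>minimal_dvd_on_ray\<close> draws the conclusion.

  Two facts connect this to visibility. First, along the ray the order of the real parts is the
  order of the numbers \<open>b\<close> (\<open>on_ray_order\<close>), so that "between" means \<open>b < B\<close>. For the points that the
  theorem allows, \<open>B / b\<close> is a positive integer, and being different from \<open>1\<close> means the same. Second,
  every integral triple with \<open>a d = b\<^sup>2 + 1\<close>, \<open>d > 0\<close>, \<open>b \<ge> 0\<close> comes from the orbit (\<open>in_orbit_iI\<close>): reduction brings a
  positive definite form of determinant \<open>1\<close> to \<open>x\<^sup>2 + y\<^sup>2\<close>.

  The geodesic arc is defined by minimal length, so the semicircle has to be shown to be
  shortest. For feet \<open>c1 < c2\<close> the function \<open>Ln ((w - c1) / (c2 - w))\<close> maps the half-plane to the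
  strip \<open>0 < Im < pi\<close>, sends the semicircle to the middle line of the strip, does not increase
  lengths when the strip carries the Euclidean metric, and preserves them on the semicircle.
  Therefore a path from \<open>p\<close> to \<open>q\<close> through \<open>w\<close> is at least as long as the Euclidean broken line through
  the three images (\<open>hyp_length_ge_dist_strip_map\<close>), and the case of equality in the triangle
  inequality puts each point of a shortest path on the arc (\<open>geodesic_arc_semicircle\<close>).
\<close>

section \<open>Length of broken lines and of paths\<close>

text \<open>The integral may be infinite. If it is finite, the derivative is absolutely integrable, so its
  gauge integral, which the fundamental theorem evaluates, is also a Lebesgue integral.\<close>

lemma ennreal_norm_diff_le_nn_integral_deriv:
  fixes g f :: "real \<Rightarrow> complex"
  assumes "a \<le> b" "finite S" "continuous_on {a..b} g"
    and deriv: "\<And>t. t \<in> {a..b} - S \<Longrightarrow> (g has_vector_derivative f t) (at t)"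
    and [measurable]: "f \<in> borel_measurable borel"
  shows "ennreal (norm (g b - g a)) \<le> (\<integral>\<^sup>+t\<in>{a..b}. ennreal (norm (f t)) \<partial>lborel)"
proof (cases "(\<integral>\<^sup>+t\<in>{a..b}. ennreal (norm (f t)) \<partial>lborel) = \<infinity>")
  case False
  define h where "h t = indicator {a..b} t *\<^sub>R f t" for t
  have h_norm: "(\<integral>\<^sup>+t. ennreal (norm (h t)) \<partial>lborel) = (\<integral>\<^sup>+t\<in>{a..b}. ennreal (norm (f t)) \<partial>lborel)"
    by (intro nn_integral_cong) (auto simp: h_def indicator_def)
  have int: "integrable lborel h"
  proof (rule integrableI_bounded)
    show "h \<in> borel_measurable lborel" unfolding h_def by measurable
    show "(\<integral>\<^sup>+t. ennreal (norm (h t)) \<partial>lborel) < \<infinity>"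
      using False by (simp add: h_norm less_top)
  qed
  have "(f has_integral (g b - g a)) {a..b}"
    by (rule fundamental_theorem_of_calculus_interior_strong[OF assms(2) assms(1)])
       (use deriv assms(3) in auto)
  then have "((\<lambda>t. if t \<in> {a..b} then f t else 0) has_integral (g b - g a)) UNIV"
    by (simp only: has_integral_restrict_UNIV)
  also have "(\<lambda>t. if t \<in> {a..b} then f t else 0) = h"
    by (auto simp: h_def indicator_def)
  finally have "g b - g a = integral\<^sup>L lborel h"
    using has_integral_integral_lborel[OF int] has_integral_unique by blast
  then show ?thesis
    using integral_norm_bound_ennreal[OF int] h_norm by simp
qed simp

lemma dist_via_point_le_nn_integral_deriv:
  fixes g f :: "real \<Rightarrow> complex"
  assumes "a \<le> c" "c \<le> b" "finite S" "continuous_on {a..b} g"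
    and deriv: "\<And>t. t \<in> {a..b} - S \<Longrightarrow> (g has_vector_derivative f t) (at t)"
    and [measurable]: "f \<in> borel_measurable borel"
  shows "ennreal (dist (g a) (g c) + dist (g c) (g b))
           \<le> (\<integral>\<^sup>+t\<in>{a..b}. ennreal (norm (f t)) \<partial>lborel)"
proof -
  have "ennreal (dist (g a) (g c) + dist (g c) (g b))
        = ennreal (norm (g c - g a)) + ennreal (norm (g b - g c))"
    by (simp add: dist_norm norm_minus_commute flip: ennreal_plus)
  also have "\<dots> \<le> (\<integral>\<^sup>+t\<in>{a..c}. ennreal (norm (f t)) \<partial>lborel)
                  + (\<integral>\<^sup>+t\<in>{c..b}. ennreal (norm (f t)) \<partial>lborel)"
    by (intro add_mono ennreal_norm_diff_le_nn_integral_deriv[OF _ \<open>finite S\<close>])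
       (use assms in \<open>auto intro: continuous_on_subset\<close>)
  also have "\<dots> = (\<integral>\<^sup>+t. ennreal (norm (f t)) * indicator {a..c} t
                       + ennreal (norm (f t)) * indicator {c..b} t \<partial>lborel)"
    by (rule nn_integral_add[symmetric]) auto
  also have "\<dots> \<le> (\<integral>\<^sup>+t\<in>{a..b}. ennreal (norm (f t)) \<partial>lborel)"
    using AE_lborel_singleton[of c]
    by (intro nn_integral_mono_AE, eventually_elim)
       (use assms(1,2) in \<open>auto simp: indicator_def\<close>)
  finally show ?thesis .
qed

section \<open>Semicircles are shortest\<close>

definition strip_map :: "real \<Rightarrow> real \<Rightarrow> complex \<Rightarrow> complex" where
  "strip_map c1 c2 w = Ln ((w - of_real c1) / (of_real c2 - w))"

text \<open>The solution \<open>w\<close> of \<open>(w - c1) / (c2 - w) = \<i> * exp u\<close>. The parameter is hyperbolic arc length.\<close>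

definition semicircle_param :: "real \<Rightarrow> real \<Rightarrow> real \<Rightarrow> complex" where
  "semicircle_param c1 c2 u =
     (of_real c1 + \<i> * of_real (c2 * exp u)) / (1 + \<i> * of_real (exp u))"

text \<open>By the right-angled triangle altitude theorem, these are the points that see the diameter from
  \<open>c1\<close> to \<open>c2\<close> at a right angle.\<close>

definition semicircle :: "real \<Rightarrow> real \<Rightarrow> complex set" where
  "semicircle c1 c2 = {w. 0 < Im w \<and> (Im w)\<^sup>2 = (Re w - c1) * (c2 - Re w)}"

lemma Im_cross_quotient_pos:
  assumes "c1 < c2" "0 < Im w"
  shows "0 < Im ((w - of_real c1) / (of_real c2 - w))"
proof -
  have "Im ((w - of_real c1) / (of_real c2 - w)) = Im w * (c2 - c1) / ((c2 - Re w)\<^sup>2 + (Im w)\<^sup>2)"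
    by (simp add: Im_divide algebra_simps)
  moreover have "0 < (c2 - Re w)\<^sup>2 + (Im w)\<^sup>2"
    using assms by (simp add: add_nonneg_pos)
  ultimately show ?thesis using assms by simp
qed

lemma strip_map_has_field_derivative:
  assumes "c1 < c2" "0 < Im w"
  shows "(strip_map c1 c2 has_field_derivative
            of_real (c2 - c1) / ((w - of_real c1) * (of_real c2 - w))) (at w)"
proof -
  have ne: "of_real c2 - w \<noteq> 0" "w - of_real c1 \<noteq> 0"
    using assms by (auto simp: complex_eq_iff)
  have "(w - of_real c1) / (of_real c2 - w) \<notin> \<real>\<^sub>\<le>\<^sub>0"
    using Im_cross_quotient_pos[OF assms] by (auto simp: complex_nonpos_Reals_iff)
  then show ?thesis
    unfolding strip_map_def
    by (auto intro!: derivative_eq_intros simp: ne divide_simps)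
qed

text \<open>In the triangle with vertices \<open>c1\<close>, \<open>c2\<close>, \<open>w\<close>, base times height is twice the area, hence at most the
  product of the two other sides.\<close>

lemma norm_strip_map_deriv_le:
  assumes "c1 < c2" "0 < Im w"
  shows "norm (of_real (c2 - c1) / ((w - of_real c1) * (of_real c2 - w))) \<le> 1 / Im w"
proof -
  have ne: "of_real c2 - w \<noteq> 0" "w - of_real c1 \<noteq> 0"
    using assms by (auto simp: complex_eq_iff)
  have "Im w * (c2 - c1) = Im ((w - of_real c1) * (of_real c2 - cnj w))"
    by (simp add: algebra_simps)
  also have "\<dots> \<le> norm ((w - of_real c1) * (of_real c2 - cnj w))"
    using abs_Im_le_cmod by (rule order_trans[OF abs_ge_self])
  also have "\<dots> = norm (w - of_real c1) * norm (cnj (of_real c2 - w))"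
    by (simp add: norm_mult)
  finally have "Im w * (c2 - c1) \<le> norm (w - of_real c1) * norm (of_real c2 - w)"
    by (simp only: complex_mod_cnj)
  moreover have "norm (complex_of_real (c2 - c1)) = c2 - c1"
    using assms by (simp only: norm_of_real)
  ultimately show ?thesis
    using assms ne by (simp only: norm_divide norm_mult) (simp add: field_simps)
qed

text \<open>The key estimate. Stating it with an intermediate point \<open>w\<close> gives minimality of the semicircle
  (take \<open>w = p\<close>) and, by the case of equality in the triangle inequality, its uniqueness.\<close>

lemma hyp_length_ge_dist_strip_map:
  assumes "c1 < c2" and path: "hyp_path p q \<gamma>" and w: "w \<in> path_image \<gamma>"
  shows "ennreal (dist (strip_map c1 c2 p) (strip_map c1 c2 w)
            + dist (strip_map c1 c2 w) (strip_map c1 c2 q)) \<le> hyp_length \<gamma>"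
proof -
  let ?G = "strip_map c1 c2"
  define G' where "G' w = complex_of_real (c2 - c1) / ((w - of_real c1) * (of_real c2 - w))" for w
  obtain c where c: "c \<in> {0..1}" "w = \<gamma> c"
    using w by (auto simp: path_image_def)
  have pos: "0 < Im (\<gamma> t)" if "t \<in> {0..1}" for t
    using path that by (force simp: hyp_path_def path_image_def upper_half_plane_def)
  obtain S D where cont: "continuous_on {0..1} \<gamma>" and S: "finite S"
    and D: "\<And>t. t \<in> {0..1} - S \<Longrightarrow> (\<gamma> has_vector_derivative D t) (at t)"
    and contD: "continuous_on ({0..1} - S) D"
    using path unfolding hyp_path_def valid_path_def piecewise_C1_differentiable_on_def
      C1_differentiable_on_def by metis
  have dG: "(?G has_field_derivative G' (\<gamma> t)) (at (\<gamma> t))" if "t \<in> {0..1}" for t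
    unfolding G'_def by (rule strip_map_has_field_derivative[OF assms(1) pos[OF that]])
  \<comment> \<open>Cutting off the exceptional points makes the derivative of the image path measurable.\<close>
  define f where "f t = indicator ({0..1} - S) t *\<^sub>R (D t * G' (\<gamma> t))" for t
  have ne: "\<gamma> t \<noteq> of_real c1" "of_real c2 \<noteq> \<gamma> t" if "t \<in> {0..1}" for t
    using pos[OF that] by (auto simp: complex_eq_iff)
  have "continuous_on ({0..1} - S) (\<lambda>t. D t * G' (\<gamma> t))"
    unfolding G'_def using ne
    by (intro continuous_intros contD continuous_on_subset[OF cont]) auto
  then have meas: "f \<in> borel_measurable borel"
    unfolding f_def using S
    by (intro borel_measurable_continuous_on_indicator sets.Diff borel_closed)
       (auto intro: finite_imp_closed)
  have contG: "continuous_on {0..1} (?G \<circ> \<gamma>)"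
    using DERIV_isCont[OF dG]
    by (intro continuous_on_compose cont continuous_at_imp_continuous_on) auto
  have derivG: "((?G \<circ> \<gamma>) has_vector_derivative f t) (at t)" if "t \<in> {0..1} - S" for t
    using field_vector_diff_chain_at[OF D[OF that] dG] that by (simp add: f_def)
  have "ennreal (dist (?G p) (?G w) + dist (?G w) (?G q))
        \<le> (\<integral>\<^sup>+t\<in>{0..1}. ennreal (norm (f t)) \<partial>lborel)"
    using dist_via_point_le_nn_integral_deriv[OF _ _ S contG derivG meas, of c] c path
    by (simp add: hyp_path_def pathstart_def pathfinish_def)
  also have "\<dots> \<le> hyp_length \<gamma>"
    unfolding hyp_length_def
  proof (intro nn_integral_mono)
    fix t :: real
    show "ennreal (norm (f t)) * indicator {0..1} t
        \<le> ennreal (norm (vector_derivative \<gamma> (at t)) / Im (\<gamma> t)) * indicator {0..1} t"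
    proof (cases "t \<in> {0..1} - S")
      case True
      have "norm (D t) * norm (G' (\<gamma> t)) \<le> norm (D t) * (1 / Im (\<gamma> t))"
        unfolding G'_def using True
        by (intro mult_left_mono norm_strip_map_deriv_le[OF assms(1) pos]) auto
      then show ?thesis
        using True vector_derivative_at[OF D[OF True]]
        by (auto simp: f_def norm_mult intro!: ennreal_leI)
    qed (auto simp: f_def)
  qed
  finally show ?thesis .
qed

lemma one_plus_i_exp_nonzero: "1 + \<i> * complex_of_real (exp u) \<noteq> 0"
  by (simp add: complex_eq_iff)

lemma
  shows Re_semicircle_param:
      "Re (semicircle_param c1 c2 u) = (c1 + c2 * (exp u)\<^sup>2) / (1 + (exp u)\<^sup>2)"
    and Im_semicircle_param:
      "Im (semicircle_param c1 c2 u) = (c2 - c1) * exp u / (1 + (exp u)\<^sup>2)"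
  unfolding semicircle_param_def
  by (simp_all add: Re_divide Im_divide power2_eq_square algebra_simps)

lemma Im_semicircle_param_pos: "c1 < c2 \<Longrightarrow> 0 < Im (semicircle_param c1 c2 u)"
  by (simp add: Im_semicircle_param add_pos_nonneg)

lemma cross_quotient_semicircle_param:
  assumes "c1 < c2"
  shows "(semicircle_param c1 c2 u - of_real c1) / (of_real c2 - semicircle_param c1 c2 u)
           = \<i> * of_real (exp u)"
proof -
  define e where "e = \<i> * complex_of_real (exp u)"
  have e: "1 + e \<noteq> 0" unfolding e_def by (rule one_plus_i_exp_nonzero)
  have s: "semicircle_param c1 c2 u = (of_real c1 + of_real c2 * e) / (1 + e)"
    by (simp add: semicircle_param_def e_def mult_ac)
  have "semicircle_param c1 c2 u - of_real c1 = of_real (c2 - c1) * e / (1 + e)"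
    "of_real c2 - semicircle_param c1 c2 u = of_real (c2 - c1) / (1 + e)"
    unfolding s using e by (simp_all add: field_simps)
  then show ?thesis using e assms by (simp add: e_def)
qed

lemma semicircle_param_eqI:
  assumes "0 < Im w" "(w - of_real c1) / (of_real c2 - w) = \<i> * of_real (exp u)"
  shows "w = semicircle_param c1 c2 u"
proof -
  have "of_real c2 - w \<noteq> 0" using assms(1) by (auto simp: complex_eq_iff)
  then have "w - of_real c1 = \<i> * of_real (exp u) * (of_real c2 - w)"
    using assms(2) by (simp add: field_simps)
  then have "w * (1 + \<i> * of_real (exp u)) = of_real c1 + \<i> * of_real (c2 * exp u)"
    by (simp add: algebra_simps)
  then show ?thesis
    unfolding semicircle_param_def using one_plus_i_exp_nonzero by (metis nonzero_eq_divide_eq)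
qed

lemma exp_pi_half: "exp (\<i> * complex_of_real pi / 2) = \<i>"
  using exp_Ln[of \<i>] by simp

lemma strip_map_semicircle_param:
  assumes "c1 < c2"
  shows "strip_map c1 c2 (semicircle_param c1 c2 u) = of_real u + \<i> * of_real (pi / 2)"
proof -
  have "Ln (\<i> * of_real (exp u)) = of_real u + \<i> * of_real (pi / 2)"
    by (rule Ln_unique) (simp_all add: exp_add exp_of_real exp_pi_half mult.commute)
  then show ?thesis
    unfolding strip_map_def cross_quotient_semicircle_param[OF assms] .
qed

lemma semicircle_param_has_vector_derivative:
  "(semicircle_param c1 c2 has_vector_derivative
      \<i> * of_real ((c2 - c1) * exp u) / (1 + \<i> * of_real (exp u))\<^sup>2) (at u)"
proof -
  define F where "F x = (of_real c1 + \<i> * of_real c2 * exp x) / (1 + \<i> * exp x)" for x :: complex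
  have e: "1 + \<i> * exp (of_real u) \<noteq> 0"
    using one_plus_i_exp_nonzero by (simp add: exp_of_real)
  have "(F has_field_derivative
      (\<i> * of_real c2 * exp (of_real u) * (1 + \<i> * exp (of_real u))
        - (of_real c1 + \<i> * of_real c2 * exp (of_real u)) * (\<i> * exp (of_real u)))
      / ((1 + \<i> * exp (of_real u)) * (1 + \<i> * exp (of_real u)))) (at (of_real u))"
    unfolding F_def using e by (auto intro!: derivative_eq_intros)
  then have "((\<lambda>x. F (of_real x)) has_vector_derivative
      (\<i> * of_real c2 * exp (of_real u) * (1 + \<i> * exp (of_real u))
        - (of_real c1 + \<i> * of_real c2 * exp (of_real u)) * (\<i> * exp (of_real u)))
      / ((1 + \<i> * exp (of_real u)) * (1 + \<i> * exp (of_real u)))) (at u)"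
    by (rule has_vector_derivative_real_field)
  moreover have "(\<lambda>x. F (of_real x)) = semicircle_param c1 c2"
    by (simp add: F_def semicircle_param_def fun_eq_iff exp_of_real mult.assoc)
  ultimately show ?thesis
    by (simp add: power2_eq_square algebra_simps flip: exp_of_real)
qed

text \<open>Unit hyperbolic speed.\<close>

lemma norm_semicircle_param_deriv:
  assumes "c1 < c2"
  shows "norm (\<i> * of_real ((c2 - c1) * exp u) / (1 + \<i> * of_real (exp u))\<^sup>2)
           = Im (semicircle_param c1 c2 u)"
proof -
  have "(norm (1 + \<i> * complex_of_real (exp u)))\<^sup>2 = 1 + (exp u)\<^sup>2"
    by (simp add: cmod_power2)
  then show ?thesis
    unfolding Im_semicircle_param using assms
    by (simp only: norm_divide norm_power norm_mult norm_ii norm_of_real) (simp add: abs_mult)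
qed

lemma
  assumes "c1 < c2" "u0 \<le> u1"
  defines "\<gamma> \<equiv> \<lambda>t. semicircle_param c1 c2 (u0 + t * (u1 - u0))"
  shows hyp_path_semicircle_param:
      "hyp_path (semicircle_param c1 c2 u0) (semicircle_param c1 c2 u1) \<gamma>"
    and hyp_length_semicircle_param: "hyp_length \<gamma> = ennreal (u1 - u0)"
    and path_image_semicircle_param: "path_image \<gamma> = semicircle_param c1 c2 ` {u0..u1}"
proof -
  define E' where "E' u = \<i> * complex_of_real ((c2 - c1) * exp u) / (1 + \<i> * of_real (exp u))\<^sup>2" for u
  have deriv: "(\<gamma> has_vector_derivative (u1 - u0) *\<^sub>R E' (u0 + t * (u1 - u0))) (at t)" for t
  proof -
    have "((\<lambda>t. u0 + t * (u1 - u0)) has_vector_derivative (u1 - u0)) (at t)"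
      by (auto intro!: derivative_eq_intros)
    from vector_diff_chain_at[OF this semicircle_param_has_vector_derivative, of c1 c2]
    show ?thesis by (simp add: \<gamma>_def o_def E'_def)
  qed
  have "continuous_on {0..1} (\<lambda>t. (u1 - u0) *\<^sub>R E' (u0 + t * (u1 - u0)))"
    unfolding E'_def using one_plus_i_exp_nonzero by (intro continuous_intros) auto
  then have "valid_path \<gamma>"
    unfolding valid_path_def using deriv
    by (intro C1_differentiable_imp_piecewise) 
      (auto simp only: C1_differentiable_on_def
        intro!: exI[of _ "\<lambda>t. (u1 - u0) *\<^sub>R E' (u0 + t * (u1 - u0))"])
  then show "hyp_path (semicircle_param c1 c2 u0) (semicircle_param c1 c2 u1) \<gamma>"
    using assms(1)
    by (auto simp: hyp_path_def path_image_def upper_half_plane_def \<gamma>_def pathstart_def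
        pathfinish_def Im_semicircle_param_pos)
  have "norm (vector_derivative \<gamma> (at t)) / Im (\<gamma> t) = u1 - u0" for t
    using vector_derivative_at[OF deriv] norm_semicircle_param_deriv[OF assms(1), folded E'_def]
      Im_semicircle_param_pos[OF assms(1)] assms(2)
    by (simp add: \<gamma>_def less_imp_neq[symmetric])
  then show "hyp_length \<gamma> = ennreal (u1 - u0)"
    by (simp add: hyp_length_def nn_integral_cmult)
  have "(\<lambda>t. u0 + t * (u1 - u0)) ` {0..1} = {u0..u1}"
    using closed_segment_real_eq[of u0 u1] assms(2)
    by (simp add: closed_segment_eq_real_ivl algebra_simps)
  then show "path_image \<gamma> = semicircle_param c1 c2 ` {u0..u1}"
    unfolding path_image_def \<gamma>_def by (metis image_image)
qed

lemma geodesic_arc_semicircle_param: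
  assumes "c1 < c2" "u0 \<le> u1"
  shows "geodesic_arc (semicircle_param c1 c2 u0) (semicircle_param c1 c2 u1)
           = semicircle_param c1 c2 ` {u0..u1}"
proof -
  let ?E = "semicircle_param c1 c2" and ?G = "strip_map c1 c2"
  define \<gamma>0 where "\<gamma>0 = (\<lambda>t. ?E (u0 + t * (u1 - u0)))"
  note \<gamma>0 = hyp_path_semicircle_param[OF assms, folded \<gamma>0_def]
    hyp_length_semicircle_param[OF assms, folded \<gamma>0_def]
    path_image_semicircle_param[OF assms, folded \<gamma>0_def]
  have dist_G: "dist (?G (?E u0)) (?G (?E u1)) = u1 - u0"
    using assms by (simp add: strip_map_semicircle_param dist_norm norm_of_real flip: of_real_diff)
  have "geodesic_path (?E u0) (?E u1) \<gamma>0"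
    unfolding geodesic_path_def
  proof (intro conjI allI impI \<gamma>0(1))
    fix \<delta> assume \<delta>: "hyp_path (?E u0) (?E u1) \<delta>"
    then have "?E u0 \<in> path_image \<delta>"
      unfolding hyp_path_def by (metis pathstart_in_path_image)
    from hyp_length_ge_dist_strip_map[OF assms(1) \<delta> this] show "hyp_length \<gamma>0 \<le> hyp_length \<delta>"
      by (simp add: dist_G \<gamma>0(2))
  qed
  then have "?E ` {u0..u1} \<subseteq> geodesic_arc (?E u0) (?E u1)"
    using \<gamma>0(3) by (auto simp: geodesic_arc_def)
  moreover have "w \<in> ?E ` {u0..u1}" if geo: "geodesic_path (?E u0) (?E u1) \<gamma>"
    and w: "w \<in> path_image \<gamma>" for \<gamma> w
  proof -
    have \<gamma>: "hyp_path (?E u0) (?E u1) \<gamma>" and min: "hyp_length \<gamma> \<le> hyp_length \<gamma>0"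
      using geo \<gamma>0(1) by (auto simp: geodesic_path_def)
    have "ennreal (dist (?G (?E u0)) (?G w) + dist (?G w) (?G (?E u1))) \<le> ennreal (u1 - u0)"
      using hyp_length_ge_dist_strip_map[OF assms(1) \<gamma> w] min \<gamma>0(2) by simp
    then have "dist (?G (?E u0)) (?G w) + dist (?G w) (?G (?E u1)) \<le> dist (?G (?E u0)) (?G (?E u1))"
      using assms(2) dist_G by (simp del: ennreal_plus)
    then have "dist (?G (?E u0)) (?G (?E u1)) = dist (?G (?E u0)) (?G w) + dist (?G w) (?G (?E u1))"
      using dist_triangle[of "?G (?E u0)" "?G (?E u1)" "?G w"] by linarith
    \<comment> \<open>Equality in the Euclidean triangle inequality confines the image to a segment of the middle line.\<close>
    then have "?G w \<in> closed_segment (?G (?E u0)) (?G (?E u1))"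
      by (simp add: between flip: between_mem_segment)
    then obtain s where s: "0 \<le> s" "s \<le> 1"
      "?G w = (1 - s) *\<^sub>R ?G (?E u0) + s *\<^sub>R ?G (?E u1)"
      by (auto simp: closed_segment_def)
    define u where "u = (1 - s) * u0 + s * u1"
    have u: "u \<in> {u0..u1}"
      using s(1,2) assms(2) convex_bound_le[of u0 u1 u1 "1-s" s] convex_bound_le[of "-u0" "-u0" "-u1" "1-s" s]
      by (auto simp: u_def)
    have Gw: "?G w = of_real u + \<i> * of_real (pi / 2)"
      unfolding s(3) strip_map_semicircle_param[OF assms(1)] u_def
      by (simp add: complex_eq_iff algebra_simps)
    have pos: "0 < Im w"
      using \<gamma> w by (auto simp: hyp_path_def upper_half_plane_def)
    have "(w - of_real c1) / (of_real c2 - w) \<noteq> 0"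
      using Im_cross_quotient_pos[OF assms(1) pos] by (metis less_irrefl zero_complex.simps(2))
    then have "(w - of_real c1) / (of_real c2 - w) = exp (?G w)"
      by (simp add: strip_map_def)
    also have "\<dots> = \<i> * of_real (exp u)"
      unfolding Gw exp_add by (simp add: exp_of_real exp_pi_half mult.commute)
    finally show ?thesis
      using semicircle_param_eqI[OF pos] u by blast
  qed
  ultimately show ?thesis
    by (auto simp: geodesic_arc_def)
qed

lemma semicircle_param_in_semicircle:
  assumes "c1 < c2"
  shows "semicircle_param c1 c2 u \<in> semicircle c1 c2"
proof -
  have ne: "1 + (exp u)\<^sup>2 \<noteq> 0" by (metis power_one sum_power2_eq_zero_iff zero_neq_one)
  have "Re (semicircle_param c1 c2 u) - c1 = (c2 - c1) * (exp u)\<^sup>2 / (1 + (exp u)\<^sup>2)"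
    "c2 - Re (semicircle_param c1 c2 u) = (c2 - c1) / (1 + (exp u)\<^sup>2)"
    unfolding Re_semicircle_param using ne by (simp_all add: field_simps)
  then show ?thesis
    using Im_semicircle_param_pos[OF assms, of u]
    by (simp add: semicircle_def Im_semicircle_param power_divide power_mult_distrib power2_eq_square)
qed

lemma Re_semicircle_param_less_iff:
  assumes "c1 < c2"
  shows "Re (semicircle_param c1 c2 u) < Re (semicircle_param c1 c2 v) \<longleftrightarrow> u < v"
proof -
  have *: "Re (semicircle_param c1 c2 u) = c2 - (c2 - c1) / (1 + (exp u)\<^sup>2)" for u
  proof -
    have "1 + (exp u)\<^sup>2 \<noteq> 0" by (metis power_one sum_power2_eq_zero_iff zero_neq_one)
    then show ?thesis unfolding Re_semicircle_param by (simp add: field_simps)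
  qed
  have pos: "1 + (exp u)\<^sup>2 > 0" for u :: real by (simp add: add_pos_nonneg)
  have "(c2 - c1) / (1 + (exp v)\<^sup>2) < (c2 - c1) / (1 + (exp u)\<^sup>2)
      \<longleftrightarrow> (c2 - c1) * (exp u)\<^sup>2 < (c2 - c1) * (exp v)\<^sup>2"
    using pos[of u] pos[of v] by (simp add: field_simps)
  also have "\<dots> \<longleftrightarrow> u < v"
    using assms by (simp add: power_mono_iff flip: not_le)
  finally show ?thesis unfolding * by simp
qed

lemma semicircle_eqI:
  assumes "v \<in> semicircle c1 c2" "w \<in> semicircle c1 c2" "Re v = Re w"
  shows "v = w"
proof -
  have "(Im v)\<^sup>2 = (Im w)\<^sup>2" using assms by (simp add: semicircle_def)
  then have "Im v = Im w"
    using assms by (auto simp: semicircle_def power2_eq_iff)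
  with assms(3) show ?thesis by (simp add: complex_eq_iff)
qed

lemma semicircle_eq_range_param:
  assumes "c1 < c2"
  shows "semicircle c1 c2 = range (semicircle_param c1 c2)"
proof (intro equalityI subsetI)
  fix w assume w: "w \<in> semicircle c1 c2"
  define x y where "x = Re w" and "y = Im w"
  have y: "0 < y" "y * y = (x - c1) * (c2 - x)"
    using w by (auto simp: semicircle_def x_def y_def power2_eq_square)
  have "0 < (x - c1) * (c2 - x)" using y by (metis mult_pos_pos)
  then have x: "0 < x - c1 \<and> 0 < c2 - x" using assms by (auto simp: zero_less_mult_iff)
  define r where "r = y / (c2 - x)"
  have r: "0 < r" using x y by (simp add: r_def)
  have "(w - of_real c1) / (of_real c2 - w) = \<i> * of_real r"
  proof -
    have "of_real c2 - w \<noteq> 0" using y by (auto simp: complex_eq_iff y_def)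
    moreover have "w - of_real c1 = \<i> * of_real r * (of_real c2 - w)"
      using x y by (simp add: complex_eq_iff r_def flip: x_def y_def) 
    ultimately show ?thesis by (simp add: field_simps)
  qed
  then have "w = semicircle_param c1 c2 (ln r)"
    using y r by (intro semicircle_param_eqI) (auto simp: y_def)
  then show "w \<in> range (semicircle_param c1 c2)" by simp
qed (use semicircle_param_in_semicircle[OF assms] in auto)

lemma geodesic_arc_semicircle:
  assumes "c1 < c2" "p \<in> semicircle c1 c2" "q \<in> semicircle c1 c2" "Re p \<le> Re q"
  shows "geodesic_arc p q = {w \<in> semicircle c1 c2. Re p \<le> Re w \<and> Re w \<le> Re q}"
proof -
  obtain u0 u1 where u: "p = semicircle_param c1 c2 u0" "q = semicircle_param c1 c2 u1"
    using assms by (auto simp: semicircle_eq_range_param)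
  have le_iff: "Re (semicircle_param c1 c2 u) \<le> Re (semicircle_param c1 c2 v) \<longleftrightarrow> u \<le> v" for u v
    using Re_semicircle_param_less_iff[OF assms(1), of v u] by linarith
  have "u0 \<le> u1" using assms(4) by (simp add: u le_iff)
  from geodesic_arc_semicircle_param[OF assms(1) this] show ?thesis
    by (auto simp: u le_iff semicircle_eq_range_param[OF assms(1)])
qed

section \<open>Arithmetic of the orbit\<close>

text \<open>Reduction of the form \<open>a x\<^sup>2 + 2 b x y + d y\<^sup>2\<close> of determinant \<open>1\<close>: every such symmetric matrix is
  \<open>g g\<^sup>T\<close> with \<open>g\<close> in \<open>SL\<^sub>2(\<int>)\<close>. If \<open>b > 0\<close>, the smaller diagonal entry is at most \<open>b\<close>, and subtracting it
  from \<open>b\<close> is an elementary row and column operation that lowers \<open>b\<close>; undoing it adds one row of \<open>g\<close>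
  to the other.\<close>

lemma exists_gram_factor:
  fixes a b d :: int
  assumes "a * d = b ^ 2 + 1" "0 < d" "0 \<le> b"
  shows "\<exists>p q r s. p * s - q * r = 1 \<and> a = p ^ 2 + q ^ 2 \<and> b = p * r + q * s \<and> d = r ^ 2 + s ^ 2"
  using assms
proof (induction "nat b" arbitrary: a b d rule: less_induct)
  case less
  have a: "0 < a"
    using less.prems by (metis add_nonneg_pos zero_le_power2 zero_less_mult_pos2 zero_less_one)
  show ?case
  proof (cases "b = 0")
    case True
    then have "a = 1" "d = 1"
      using less.prems a by (auto simp: zmult_eq_1_iff)
    then have "1 * 1 - 0 * 0 = (1 :: int) \<and> a = 1 ^ 2 + 0 ^ 2 \<and> b = 1 * 0 + 0 * 1 \<and> d = 0 ^ 2 + 1 ^ 2"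
      using True by simp
    then show ?thesis by blast
  next
    case False
    then have b: "0 < b" using less.prems by simp
    show ?thesis
    proof (cases "a \<le> d")
      case True
      have "a \<le> b"
      proof (rule ccontr)
        assume "\<not> a \<le> b"
        then have "(b + 1) * (b + 1) \<le> a * d" using True b by (intro mult_mono) auto
        then show False using less.prems(1) b by (simp add: power2_eq_square algebra_simps)
      qed
      have eq: "a * (d - 2 * b + a) = (b - a) ^ 2 + 1"
        using less.prems(1) by (simp add: power2_eq_square algebra_simps)
      then have "0 < d - 2 * b + a"
        using a by (metis add_nonneg_pos zero_le_power2 zero_less_mult_pos zero_less_one)
      from less.hyps[OF _ eq this] \<open>a \<le> b\<close> a obtain p q r s where
        *: "p * s - q * r = 1" "a = p ^ 2 + q ^ 2" "b - a = p * r + q * s"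
          "d - 2 * b + a = r ^ 2 + s ^ 2" by auto
      have "p * (s + q) - q * (r + p) = p * s - q * r"
        "p * (r + p) + q * (s + q) = (p * r + q * s) + (p ^ 2 + q ^ 2)"
        "(r + p) ^ 2 + (s + q) ^ 2 = (r ^ 2 + s ^ 2) + 2 * (p * r + q * s) + (p ^ 2 + q ^ 2)"
        by (simp_all add: power2_eq_square algebra_simps)
      moreover have "b = (p * r + q * s) + (p ^ 2 + q ^ 2)"
        "d = (r ^ 2 + s ^ 2) + 2 * (p * r + q * s) + (p ^ 2 + q ^ 2)"
        using *(2-4) by (smt (verit))+
      ultimately have "p * (s + q) - q * (r + p) = 1" "b = p * (r + p) + q * (s + q)"
        "d = (r + p) ^ 2 + (s + q) ^ 2"
        using *(1) by metis+
      with *(2) show ?thesis by blast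
    next
      case False
      have "d \<le> b"
      proof (rule ccontr)
        assume "\<not> d \<le> b"
        then have "(b + 1) * (b + 1) \<le> a * d" using False b by (intro mult_mono) auto
        then show False using less.prems(1) b by (simp add: power2_eq_square algebra_simps)
      qed
      have eq: "(a - 2 * b + d) * d = (b - d) ^ 2 + 1"
        using less.prems(1) by (simp add: power2_eq_square algebra_simps)
      from less.hyps[OF _ eq \<open>0 < d\<close>] \<open>d \<le> b\<close> \<open>0 < d\<close> obtain p q r s where
        *: "p * s - q * r = 1" "a - 2 * b + d = p ^ 2 + q ^ 2" "b - d = p * r + q * s"
          "d = r ^ 2 + s ^ 2" by auto
      have "(p + r) * s - (q + s) * r = p * s - q * r"
        "(p + r) * r + (q + s) * s = (p * r + q * s) + (r ^ 2 + s ^ 2)"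
        "(p + r) ^ 2 + (q + s) ^ 2 = (p ^ 2 + q ^ 2) + 2 * (p * r + q * s) + (r ^ 2 + s ^ 2)"
        by (simp_all add: power2_eq_square algebra_simps)
      moreover have "b = (p * r + q * s) + (r ^ 2 + s ^ 2)"
        "a = (p ^ 2 + q ^ 2) + 2 * (p * r + q * s) + (r ^ 2 + s ^ 2)"
        using *(2-4) by (smt (verit))+
      ultimately have "(p + r) * s - (q + s) * r = 1" "b = (p + r) * r + (q + s) * s"
        "a = (p + r) ^ 2 + (q + s) ^ 2"
        using *(1) by metis+
      with *(4) show ?thesis by blast
    qed
  qed
qed

lemma in_orbit_iI:
  fixes a b d :: int
  assumes "a * d = b ^ 2 + 1" "0 < d" "0 \<le> b"
  shows "(of_int b + \<i>) / of_int d \<in> orbit_i"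
proof -
  obtain p q r s where *: "p * s - q * r = 1" "b = p * r + q * s" "d = r ^ 2 + s ^ 2"
    using exists_gram_factor[OF assms] by blast
  define M :: "int^2^2" where "M = vector [vector [p, q], vector [r, s]]"
  have M: "M$1$1 = p" "M$1$2 = q" "M$2$1 = r" "M$2$2 = s"
    by (simp_all add: M_def)
  have ne: "of_int r * \<i> + of_int s \<noteq> (0::complex)"
    using * assms(2) by (auto simp: complex_eq_iff)
  have det: "of_int p * of_int s - of_int q * of_int r = (1::complex)"
    using arg_cong[OF *(1), of "of_int :: int \<Rightarrow> complex"] by simp
  have "(of_int p * \<i> + of_int q) * of_int d
        = (of_int b + (of_int p * of_int s - of_int q * of_int r) * \<i>) * (of_int r * \<i> + of_int s)"
    by (simp add: * complex_eq_iff algebra_simps power2_eq_square)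
  then have "(of_int b + \<i>) / of_int d = frac_lin M \<i>"
    using ne assms(2) det by (simp add: frac_lin_def M field_simps)
  moreover have "M \<in> SL2Z" using * by (simp add: SL2Z_def det_2 M)
  ultimately show ?thesis by (auto simp: orbit_i_def)
qed

text \<open>The matrices with rows \<open>(a, b)\<close> and \<open>(b, d)\<close> of determinant \<open>1\<close> with \<open>(d - a) : b = m : n\<close>. For
  \<open>n > 0\<close> the points \<open>(b + \<i>) / d\<close> lie on one geodesic ray from \<open>\<i>\<close>. The slope is kept as a pair of integers
  so that the condition needs no division.\<close>

definition on_ray :: "int \<Rightarrow> int \<Rightarrow> int \<Rightarrow> int \<Rightarrow> int \<Rightarrow> bool" where
  "on_ray m n a b d \<longleftrightarrow> a * d = b ^ 2 + 1 \<and> 0 < d \<and> 0 < b \<and> (d - a) * n = m * b"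

lemma on_ray_pos: "on_ray m n a b d \<Longrightarrow> 0 < a"
  unfolding on_ray_def
  by (metis add_nonneg_pos zero_le_power2 zero_less_mult_pos2 zero_less_one)

text \<open>Equivalently, the two matrices commute.\<close>

lemma on_ray_proportional:
  assumes "0 < n" "on_ray m n a b d" "on_ray m n A B D"
  shows "(d - a) * B = (D - A) * b"
proof -
  have "(d - a) * n * B = (D - A) * n * b"
    using assms by (simp add: on_ray_def mult_ac)
  then have "((d - a) * B) * n = ((D - A) * b) * n" by (simp add: mult_ac)
  then show ?thesis using assms(1) by simp
qed

text \<open>Commuting gives \<open>a B - A b = d B - D b\<close>, so the two differences have the same sign, which is then
  the sign of \<open>(a B)(d B) - (A b)(D b) = B\<^sup>2 - b\<^sup>2\<close>.\<close>

lemma on_ray_order: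
  assumes "0 < n" "on_ray m n a b d" "on_ray m n A B D"
  shows "b * D < B * d \<longleftrightarrow> b < B"
proof -
  note proportional = on_ray_proportional[OF assms]
  have r: "a * d = b ^ 2 + 1" "0 < d" "0 < b" "0 < a" "A * D = B ^ 2 + 1" "0 < D" "0 < B" "0 < A"
    using assms on_ray_pos[OF assms(2)] on_ray_pos[OF assms(3)] by (simp_all add: on_ray_def)
  have expand: "(a * B) * (d * B) = b^2 * B^2 + B ^ 2" "(A * b) * (D * b) = b^2 * B^2 + b ^ 2"
  proof -
    have "(a * B) * (d * B) = (a * d) * B\<^sup>2" "(A * b) * (D * b) = (A * D) * b\<^sup>2"
      by (simp_all add: power2_eq_square)
    then show "(a * B) * (d * B) = b^2 * B^2 + B ^ 2" "(A * b) * (D * b) = b^2 * B^2 + b ^ 2"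
      unfolding r(1,5) by (simp_all add: algebra_simps)
  qed
  have diff: "a * B - A * b = d * B - D * b"
    using proportional by (simp add: algebra_simps)
  show ?thesis
  proof
    assume "b * D < B * d"
    then have lt: "D * b < d * B" "A * b < a * B" using diff by (auto simp: mult.commute)
    then have "(A * b) * (D * b) < (a * B) * (d * B)"
      using r by (intro mult_strict_mono[OF _ _ mult_pos_pos less_imp_le[OF mult_pos_pos]]) auto
    then have "b ^ 2 < B ^ 2" using expand by simp
    then show "b < B" using r by (simp add: power2_less_imp_less)
  next
    assume "b < B"
    show "b * D < B * d"
    proof (rule ccontr)
      assume "\<not> b * D < B * d"
      then have "d * B \<le> D * b" "a * B \<le> A * b" using diff by (auto simp: mult.commute)
      then have "(a * B) * (d * B) \<le> (A * b) * (D * b)"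
        using r by (intro mult_mono[OF _ _ less_imp_le[OF mult_pos_pos] less_imp_le[OF mult_pos_pos]]) auto
      then have "B ^ 2 \<le> b ^ 2" using expand by simp
      then show False using \<open>b < B\<close> r power2_le_imp_le[of B b] by simp
    qed
  qed
qed

text \<open>The new triple is the product of the larger matrix with the inverse of the smaller one; it is
  symmetric because the two commute. The last equation is the off-diagonal entry of
  quotient times smaller matrix.\<close>

lemma on_ray_quotient:
  assumes "0 < n" "on_ray m n a b d" "on_ray m n A B D" "b < B"
  shows "on_ray m n (A * d - B * b) (B * d - D * b) (D * a - B * b)"
    and "B * d - D * b < B"
    and "B = (B * d - D * b) * d + (A * d - B * b) * b"
proof -
  note proportional = on_ray_proportional[OF assms(1-3)]
  have r: "a * d = b ^ 2 + 1" "0 < d" "0 < b" "0 < a" "A * D = B ^ 2 + 1" "0 < D" "0 < B" "0 < A"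
    "(d - a) * n = m * b" "(D - A) * n = m * B"
    using assms on_ray_pos[OF assms(2)] on_ray_pos[OF assms(3)] by (simp_all add: on_ray_def)
  have pos: "0 < B * d - D * b"
    using on_ray_order[OF assms(1-3)] assms(4) by (simp add: mult.commute)
  have det: "(A * d - B * b) * (D * a - B * b) = (B * d - D * b) ^ 2 + 1"
    using proportional r(1,5) by algebra
  have line: "((D * a - B * b) - (A * d - B * b)) * n = m * (B * d - D * b)"
    using proportional r(1,5,9,10) by algebra
  show B: "B = (B * d - D * b) * d + (A * d - B * b) * b"
    using proportional r(1,5) by algebra
  have posD: "0 < D * a - B * b"
  proof (rule ccontr)
    assume neg: "\<not> 0 < D * a - B * b"
    have "0 < (A * d - B * b) * (D * a - B * b)"
      unfolding det by (simp add: add_nonneg_pos)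
    \<comment> \<open>Both diagonal entries would be negative, against \<open>A D a d > B\<^sup>2 b\<^sup>2\<close>.\<close>
    then have "A * d < B * b" "D * a < B * b" using neg by (auto simp: zero_less_mult_iff)
    then have "(A * d) * (D * a) < (B * b) * (B * b)"
      by (rule mult_strict_mono) (use r in auto)
    moreover have "(A * d) * (D * a) = (B ^ 2 + 1) * (b ^ 2 + 1)"
      unfolding r(1,5)[symmetric] by simp
    ultimately show False by (simp add: power2_eq_square algebra_simps) (smt (verit) zero_le_square)
  qed
  show new: "on_ray m n (A * d - B * b) (B * d - D * b) (D * a - B * b)"
    unfolding on_ray_def using det line pos posD by blast
  have "(B * d - D * b) * 1 \<le> (B * d - D * b) * d"
    using pos r by (intro mult_left_mono) auto
  moreover have "0 < (A * d - B * b) * b"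
    using on_ray_pos[OF new] r by simp
  ultimately have "(B * d - D * b) * 1 + 0 < (B * d - D * b) * d + (A * d - B * b) * b"
    by (rule add_le_less_mono)
  then show "B * d - D * b < B" unfolding B[symmetric] by simp
qed

text \<open>Euclidean descent: dividing by the minimal matrix lowers \<open>B\<close> and stays on the ray until the
  minimal matrix itself is reached.\<close>

lemma minimal_dvd_on_ray:
  assumes "0 < n" and base: "on_ray m n a b d"
    and minimal: "\<And>a' b' d'. on_ray m n a' b' d' \<Longrightarrow> b \<le> b'"
    and "on_ray m n A B D"
  shows "b dvd B"
  using assms(4)
proof (induction "nat B" arbitrary: A B D rule: less_induct)
  case less
  show ?case
  proof (cases "B = b")
    case False
    then have "b < B" using minimal[OF less.prems] by simp
    note q = on_ray_quotient[OF assms(1) base less.prems this]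
    have "0 < B" using less.prems by (simp add: on_ray_def)
    with q(2) have "nat (B * d - D * b) < nat B" by simp
    from less.hyps[OF this q(1)] have "b dvd (B * d - D * b) * d + (A * d - B * b) * b"
      by simp
    then show ?thesis using q(3) by simp
  qed simp
qed

lemma exists_proper_divisor_on_ray:
  assumes "0 < n" "on_ray m n a b d" "on_ray m n A B D" "b < B"
  shows "\<exists>a b d. on_ray m n a b d \<and> b < B \<and> b dvd B"
proof -
  define k where "k = (LEAST k. \<exists>a d. on_ray m n a (int k) d)"
  have "\<exists>a d. on_ray m n a (int (nat b)) d"
    using assms(2) by (auto simp: on_ray_def)
  then have "\<exists>a d. on_ray m n a (int k) d" and "k \<le> nat b"
    unfolding k_def by (rule LeastI, rule Least_le)
  then obtain a0 d0 where base: "on_ray m n a0 (int k) d0" by blast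
  have "int k \<le> b'" if "on_ray m n a' b' d'" for a' b' d'
  proof -
    have "\<exists>a d. on_ray m n a (int (nat b')) d"
      using that by (auto simp: on_ray_def)
    then have "k \<le> nat b'" unfolding k_def by (rule Least_le)
    then show ?thesis using that by (auto simp: on_ray_def)
  qed
  from minimal_dvd_on_ray[OF assms(1) base this assms(3)] have "int k dvd B" .
  moreover have "int k < B" using \<open>k \<le> nat b\<close> assms(2,4) by (auto simp: on_ray_def)
  ultimately show ?thesis using base by blast
qed

section \<open>Visibility\<close>

text \<open>The feet of the semicircle through \<open>\<i>\<close> with centre \<open>- \<sigma> / 2\<close>; the condition \<open>c1 * c2 = - 1\<close> says that
  it passes through \<open>\<i>\<close>.\<close>

lemma exists_feet:
  fixes \<sigma> :: real
  shows "\<exists>c1 c2. c1 < c2 \<and> c1 + c2 = - \<sigma> \<and> c1 * c2 = - 1"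
proof -
  define h where "h = sqrt (\<sigma>\<^sup>2 / 4 + 1)"
  have "0 < h" "h * h = \<sigma>\<^sup>2 / 4 + 1"
    by (simp_all add: h_def add_nonneg_pos)
  then show ?thesis
    by (intro exI[of _ "- \<sigma> / 2 - h"] exI[of _ "- \<sigma> / 2 + h"])
       (simp add: algebra_simps power2_eq_square)
qed

lemma orbit_point_on_semicircle_iff:
  fixes a b d m n :: int
  assumes "a * d = b ^ 2 + 1" "0 < d" "0 < n"
    and c: "c1 + c2 = - (of_int m / of_int n)" "c1 * c2 = - 1"
  shows "(of_int b + \<i>) / of_int d \<in> semicircle c1 c2 \<longleftrightarrow> (d - a) * n = m * b"
proof -
  let ?a = "real_of_int a" and ?b = "real_of_int b" and ?d = "real_of_int d"
  have ad: "?a * ?d = ?b\<^sup>2 + 1" using arg_cong[OF assms(1), of real_of_int] by simp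
  have "(?b / ?d - c1) * (c2 - ?b / ?d) = (c1 + c2) * (?b / ?d) - (?b / ?d)\<^sup>2 - c1 * c2"
    by algebra
  also have "\<dots> = 1 - (of_int m / of_int n) * (?b / ?d) - (?b / ?d)\<^sup>2"
    by (simp add: c)
  finally have "(1 / ?d)\<^sup>2 = (?b / ?d - c1) * (c2 - ?b / ?d)
      \<longleftrightarrow> (1 / ?d)\<^sup>2 + (?b / ?d)\<^sup>2 = 1 - (of_int m / of_int n) * (?b / ?d)"
    by linarith
  also have "(1 / ?d)\<^sup>2 + (?b / ?d)\<^sup>2 = ?a / ?d"
  proof -
    have "(1 / ?d)\<^sup>2 + (?b / ?d)\<^sup>2 = (?a * ?d) / ?d\<^sup>2"
      unfolding ad by (simp add: power_divide add_divide_distrib)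
    then show ?thesis using assms(2) by (simp add: power2_eq_square)
  qed
  also have "?a / ?d = 1 - (of_int m / of_int n) * (?b / ?d) \<longleftrightarrow> (?d - ?a) * of_int n = of_int m * ?b"
    using assms(2,3) by (simp add: field_simps) linarith
  also have "\<dots> \<longleftrightarrow> real_of_int ((d - a) * n) = real_of_int (m * b)" by simp
  also have "\<dots> \<longleftrightarrow> (d - a) * n = m * b" by (rule of_int_eq_iff)
  finally show ?thesis
    using assms(2) by (simp add: semicircle_def)
qed

text \<open>The region \<open>Q1\<close> gives \<open>A / D = (norm z)\<^sup>2 \<le> 1\<close> and \<open>0 \<le> B\<close>. The boundary cases \<open>A = D\<close> and \<open>B = 0\<close> would
  need two consecutive squares \<open>B\<^sup>2\<close> and \<open>D\<^sup>2\<close> with \<open>0 < B\<close>, or \<open>z = \<i>\<close>.\<close>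

lemma coordinates_of_Q1:
  fixes A B D :: int
  assumes "z \<in> orbit_i_star \<inter> Q1" "z = (of_int B + \<i>) / of_int D"
    and "real_of_int A = (real_of_int B ^ 2 + 1) / real_of_int D"
  shows "A * D = B ^ 2 + 1" "0 < D" "0 < B" "A < D"
proof -
  have "0 < Im z" "norm z \<le> 1" "0 \<le> Re z" "z \<noteq> \<i>"
    using assms(1) by (auto simp: orbit_i_star_def Q1_def upper_half_plane_def)
  note z = this[unfolded assms(2)]
  show D: "0 < D" using z(1) by (simp add: zero_less_divide_iff)
  have B: "0 \<le> B" using z(3) D by (simp add: zero_le_divide_iff)
  have "real_of_int (A * D) = real_of_int (B ^ 2 + 1)" using assms(3) D by simp
  then show AD: "A * D = B ^ 2 + 1" by (simp only: of_int_eq_iff)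
  have "B \<noteq> 0"
  proof
    assume "B = 0"
    with AD D have "D = 1" by (simp add: zmult_eq_1_iff)
    with \<open>B = 0\<close> z(4) show False by simp
  qed
  with B show Bpos: "0 < B" by simp
  have "(norm ((of_int B + \<i>) / complex_of_int D))\<^sup>2 = real_of_int A / of_int D"
    using assms(3) D by (simp add: norm_divide power_divide cmod_power2) (simp add: power2_eq_square)
  moreover have "(norm ((of_int B + \<i>) / complex_of_int D))\<^sup>2 \<le> 1"
    using z(2) by (simp add: power_le_one)
  ultimately have "A \<le> D" using D by simp
  moreover have "A \<noteq> D"
  proof
    assume "A = D"
    then have "D * D = B * B + 1" using AD by (simp add: power2_eq_square)
    moreover have "B < D"
      using calculation Bpos D by (smt (verit) mult_mono)
    then have "(B + 1) * (B + 1) \<le> D * D" using Bpos by (intro mult_mono) auto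
    ultimately show False using Bpos by (simp add: algebra_simps)
  qed
  ultimately show "A < D" by simp
qed

lemma not_visible_iff_smaller_on_ray:
  fixes A B D :: int
  assumes "A * D = B ^ 2 + 1" "0 < D" "0 < B"
  shows "\<not> visible ((of_int B + \<i>) / of_int D) \<longleftrightarrow> (\<exists>a b d. on_ray (D - A) B a b d \<and> b < B)"
proof -
  let ?z = "(of_int B + \<i>) / complex_of_int D"
  have ray: "on_ray (D - A) B A B D" using assms by (simp add: on_ray_def)
  obtain c1 c2 where c: "c1 < c2" "c1 + c2 = - (real_of_int (D - A) / of_int B)" "c1 * c2 = - 1"
    using exists_feet by blast
  note mem_iff = orbit_point_on_semicircle_iff[OF _ _ assms(3) c(2,3)]
  have i: "\<i> \<in> semicircle c1 c2" using c by (simp add: semicircle_def)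
  have z: "?z \<in> semicircle c1 c2" using mem_iff[OF assms(1,2)] by simp
  have arc: "geodesic_arc \<i> ?z = {w \<in> semicircle c1 c2. 0 \<le> Re w \<and> Re w \<le> Re ?z}"
    using geodesic_arc_semicircle[OF c(1) i z] assms by simp
  have vis: "visible ?z \<longleftrightarrow> geodesic_arc \<i> ?z \<inter> orbit_i \<subseteq> {\<i>, ?z}"
    using in_orbit_iI[OF assms(1,2)] assms by (auto simp: visible_def complex_eq_iff)
  show ?thesis
  proof
    assume "\<not> visible ?z"
    then obtain w where w: "w \<in> semicircle c1 c2" "0 \<le> Re w" "Re w \<le> Re ?z" "w \<in> orbit_i"
      "w \<noteq> \<i>" "w \<noteq> ?z"
      unfolding vis arc by blast
    obtain a b d :: int where abd: "w = (of_int b + \<i>) / of_int d" "0 < d"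
      "real_of_int a = (real_of_int b ^ 2 + 1) / real_of_int d"
      using orbit_i_coordinates[OF w(4)] by blast
    have "real_of_int (a * d) = real_of_int (b ^ 2 + 1)" using abd by simp
    then have ad: "a * d = b ^ 2 + 1" by (simp only: of_int_eq_iff)
    have "0 \<noteq> Re w" using semicircle_eqI[OF i w(1)] w(5) by auto
    then have "0 < Re w" using w(2) by simp
    then have b: "0 < b" using abd by (simp add: zero_less_divide_iff)
    have "Re w \<noteq> Re ?z" using semicircle_eqI[OF w(1) z] w(6) by blast
    then have "Re w < Re ?z" using w(3) by simp
    then have "real_of_int b / of_int d < of_int B / of_int D" using abd by simp
    then have "real_of_int (b * D) < real_of_int (B * d)"
      using abd(2) assms(2) by (simp add: field_simps)
    then have less: "b * D < B * d" by (simp only: of_int_less_iff)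
    have new: "on_ray (D - A) B a b d"
      using mem_iff[OF ad abd(2)] w(1) abd ad b by (simp add: on_ray_def)
    show "\<exists>a b d. on_ray (D - A) B a b d \<and> b < B"
      using new less on_ray_order[OF assms(3) new ray] by blast
  next
    assume "\<exists>a b d. on_ray (D - A) B a b d \<and> b < B"
    then obtain a b d where abd: "on_ray (D - A) B a b d" "b < B" by blast
    let ?w = "(of_int b + \<i>) / complex_of_int d"
    have r: "a * d = b ^ 2 + 1" "0 < d" "0 < b" "(d - a) * B = (D - A) * b"
      using abd(1) by (auto simp: on_ray_def)
    have "b * D < B * d" using on_ray_order[OF assms(3) abd(1) ray] abd(2) by blast
    then have "real_of_int (b * D) < real_of_int (B * d)" by (simp only: of_int_less_iff)
    then have lt: "Re ?w < Re ?z" using r assms by (simp add: field_simps)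
    then have "?w \<noteq> ?z" by (metis less_irrefl)
    have "?w \<in> geodesic_arc \<i> ?z"
      unfolding arc using mem_iff[OF r(1,2)] r lt by simp
    moreover have "?w \<in> orbit_i" using in_orbit_iI[OF r(1,2)] r by simp
    moreover have "?w \<noteq> \<i>" using r by (auto simp: complex_eq_iff)
    ultimately show "\<not> visible ?z" using \<open>?w \<noteq> ?z\<close> unfolding vis by blast
  qed
qed

theorem theorem3p3:
  fixes z :: complex and A B D :: int
  assumes "z \<in> orbit_i_star \<inter> Q1"
    and "z = (of_int B + \<i>) / of_int D"
    and "real_of_int A = (real_of_int B ^ 2 + 1) / real_of_int D"
  shows "\<not> visible z \<longleftrightarrow>
    (\<exists>a b d :: int. 1 \<le> a \<and> a \<le> b \<and> b < d \<and> a * d = b ^ 2 + 1 \<and> b dvd B \<and>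
       real_of_int B / real_of_int b = real_of_int (D - A) / real_of_int (d - a) \<and>
       real_of_int (D - A) / real_of_int (d - a) \<noteq> 1)"
proof -
  note co = coordinates_of_Q1[OF assms]
  have ray: "on_ray (D - A) B A B D" using co by (simp add: on_ray_def)
  show ?thesis
    unfolding assms(2) not_visible_iff_smaller_on_ray[OF co(1-3)]
  proof
    assume "\<exists>a b d. on_ray (D - A) B a b d \<and> b < B"
    then obtain a b d where abd: "on_ray (D - A) B a b d" "b < B" "b dvd B"
      using exists_proper_divisor_on_ray[OF co(3) _ ray] by blast
    have r: "a * d = b ^ 2 + 1" "0 < d" "0 < b" "(d - a) * B = (D - A) * b" "0 < a"
      using abd(1) on_ray_pos[OF abd(1)] by (auto simp: on_ray_def)
    have "0 < (d - a) * B" using r co by simp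
    then have "a < d" using co(3) by (simp add: zero_less_mult_iff)
    \<comment> \<open>\<open>a < d\<close> and \<open>a d = b\<^sup>2 + 1\<close> leave no room for both factors to exceed \<open>b\<close>.\<close>
    have "a \<le> b"
    proof (rule ccontr)
      assume "\<not> a \<le> b"
      then have "(b + 1) * (b + 2) \<le> a * d" using r \<open>a < d\<close> by (intro mult_mono) auto
      then show False using r by (simp add: power2_eq_square algebra_simps)
    qed
    have "b < d"
    proof (rule ccontr)
      assume "\<not> b < d"
      then have "a * d \<le> b * b" using r \<open>a \<le> b\<close> by (intro mult_mono) auto
      then show False using r by (simp add: power2_eq_square)
    qed
    have "real_of_int ((d - a) * B) = real_of_int ((D - A) * b)" using r by simp
    then have ratio: "real_of_int B / real_of_int b = real_of_int (D - A) / real_of_int (d - a)"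
      using r \<open>a < d\<close> by (simp add: field_simps)
    have "real_of_int B / real_of_int b \<noteq> 1" using abd(2) r by simp
    then show "\<exists>a b d :: int. 1 \<le> a \<and> a \<le> b \<and> b < d \<and> a * d = b ^ 2 + 1 \<and> b dvd B \<and>
       real_of_int B / real_of_int b = real_of_int (D - A) / real_of_int (d - a) \<and>
       real_of_int (D - A) / real_of_int (d - a) \<noteq> 1"
      using r \<open>a \<le> b\<close> \<open>b < d\<close> abd(3) ratio by (intro exI[of _ a] exI[of _ b] exI[of _ d]) auto
  next
    assume "\<exists>a b d :: int. 1 \<le> a \<and> a \<le> b \<and> b < d \<and> a * d = b ^ 2 + 1 \<and> b dvd B \<and>
       real_of_int B / real_of_int b = real_of_int (D - A) / real_of_int (d - a) \<and>
       real_of_int (D - A) / real_of_int (d - a) \<noteq> 1"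
    then obtain a b d :: int where abd: "1 \<le> a" "a \<le> b" "b < d" "a * d = b ^ 2 + 1" "b dvd B"
      and ratio: "real_of_int B / real_of_int b = real_of_int (D - A) / real_of_int (d - a)"
      and ne: "real_of_int (D - A) / real_of_int (d - a) \<noteq> 1" by blast
    \<comment> \<open>The ratio is \<open>B / b\<close>, so excluding \<open>1\<close> sharpens \<open>b \<le> B\<close>, which divisibility gives.\<close>
    have "b \<noteq> B" using ne abd unfolding ratio[symmetric] by auto
    moreover have "b \<le> B" using abd(5) co(3) by (rule zdvd_imp_le)
    moreover have "real_of_int ((d - a) * B) = real_of_int ((D - A) * b)"
      using ratio abd by (simp add: field_simps)
    then have "(d - a) * B = (D - A) * b" by (simp only: of_int_eq_iff)
    ultimately show "\<exists>a b d. on_ray (D - A) B a b d \<and> b < B"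
      using abd by (intro exI[of _ a] exI[of _ b] exI[of _ d]) (auto simp: on_ray_def)
  qed
qed

end
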